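(* Let $f:\mathbb R^n\to\mathbb R^n$ ($n\ge 2$) be smooth, let $x^\star$ be a non-trivial $T$-periodic solution of $\dot x=f(x)$ with $f(x^\star(t))\neq 0$ for all $t$, and let $z(\cdot)$, $S(\cdot)$ and $\Pi(\cdot)$ be the transversal normal field, transversal hyperplanes and projection operator described in the context. Let $x(\cdot)$ be a solution of $\dot x=f(x)$ on an open time interval $I$, and let $\tau(\cdot):I\to\mathbb R$ be continuous with $x(t)\in S(\tau(t))$ for all $t\in I$. Put $x_\perp(t)=\Pi(\tau(t))\,\big(x(t)-x^\star(\tau(t))\big)\in\mathbb R^{n-1}$, and suppose $$z(\tau)^\top f(x^\star(\tau))-\Big(\frac{d z(\tau)}{d\tau}\Big)^{\!\top}\Pi(\tau)^\top x_\perp\neq 0$$ at $(x_\perp,\tau)=(x_\perp(t),\tau(t))$ for all $t\in I$. Then the dynamics of the system in the coordinates $(x_\perp,\tau)$ are given on $I$ by $$\dot x_\perp=\dot\tau\Big[\frac{d}{d\tau}\Pi(\tau)\Big]\Pi(\tau)^\top x_\perp+\Pi(\tau)f\big(x^\star(\tau)+\Pi(\tau)^\top x_\perp\big)-\Pi(\tau)f(x^\star(\tau))\,\dot\tau,$$ $$\dot\tau=\frac{z(\tau)^\top f\big(x^\star(\tau)+\Pi(\tau)^\top x_\perp\big)}{z(\tau)^\top f(x^\star(\tau))-\big(\frac{d z(\tau)}{d\tau}\big)^{\top}\Pi(\tau)^\top x_\perp}.$$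
   Context: Vectors are columns and $^\top$ denotes transpose. Transversal hyperplanes: $z:\mathbb R\to\mathbb R^n$ is a smooth $T$-periodic function with bounded derivative, $\|z(\tau)\|=1$ for all $\tau$, and there is $\delta>0$ with $z(\tau)^\top f(x^\star(\tau))>\delta$ for all $\tau$. For each $\tau$, $S(\tau)=\{y\in\mathbb R^n: z(\tau)^\top(y-x^\star(\tau))=0\}$. Projection operator: for $n\ge 3$, fix an orthonormal basis $\eta_1,\dots,\eta_n$ of $\mathbb R^n$ such that $\eta_1$ is not collinear with $z(\tau)$ for any $\tau$, and set $$\xi_j(\tau)=\eta_j-\frac{\eta_j^\top z(\tau)}{1+\eta_1^\top z(\tau)}\,(\eta_1+z(\tau)),\qquad j=2,\dots,n.$$ For $n=2$, set $\xi_2(\tau)=(-z_2(\tau),z_1(\tau))^\top$. Then $\Pi(\tau)$ is the $(n-1)\times n$ matrix with rows $\xi_2(\tau)^\top,\dots,\xi_n(\tau)^\top$. *)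

theory Defs
  imports "HOL-Analysis.Analysis"
begin

(* C^k in the sense of existence and continuity of all iterated directional derivatives;
   on finite-dimensional domains this is the usual notion. *)
primrec Ck :: "nat \<Rightarrow> ('a::real_normed_vector \<Rightarrow> 'b::real_normed_vector) \<Rightarrow> bool" where
  "Ck 0 f \<longleftrightarrow> continuous_on UNIV f"
| "Ck (Suc k) f \<longleftrightarrow> (\<forall>x. f differentiable (at x)) \<and>
     (\<forall>v. Ck k (\<lambda>x. frechet_derivative f (at x) v))"

definition smooth :: "('a::real_normed_vector \<Rightarrow> 'b::real_normed_vector) \<Rightarrow> bool" where
  "smooth f \<longleftrightarrow> (\<forall>k. Ck k f)"

definition solution_on :: "real set \<Rightarrow> ('a::real_normed_vector \<Rightarrow> 'a) \<Rightarrow> (real \<Rightarrow> 'a) \<Rightarrow> bool" where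
  "solution_on I f x \<longleftrightarrow> (\<forall>t\<in>I. (x has_vector_derivative f (x t)) (at t within I))"

definition hyperplane :: "(real \<Rightarrow> 'a::real_inner) \<Rightarrow> (real \<Rightarrow> 'a) \<Rightarrow> real \<Rightarrow> 'a set" where
  "hyperplane z xstar \<tau> = {y. z \<tau> \<bullet> (y - xstar \<tau>) = 0}"

definition orthonormal_basis :: "(nat \<Rightarrow> real ^ 'n::finite) \<Rightarrow> bool" where
  "orthonormal_basis \<eta> \<longleftrightarrow>
     (\<forall>i\<in>{1..CARD('n)}. \<forall>j\<in>{1..CARD('n)}. \<eta> i \<bullet> \<eta> j = (if i = j then 1 else 0)) \<and>
     span (\<eta> ` {1..CARD('n)}) = UNIV"

(* coord enumerates the coordinates of real ^ 'n as 1, ..., n; in dimension 2 the value is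
   the vector (- z_2, z_1), independently of j and \<eta>. *)
definition xi :: "(nat \<Rightarrow> 'n::finite) \<Rightarrow> (nat \<Rightarrow> real ^ 'n) \<Rightarrow> (real \<Rightarrow> real ^ 'n)
    \<Rightarrow> nat \<Rightarrow> real \<Rightarrow> real ^ 'n" where
  "xi coord \<eta> z j \<tau> =
     (if CARD('n) = 2
      then (\<chi> i. if i = coord 1 then - (z \<tau> $ coord 2) else z \<tau> $ coord 1)
      else \<eta> j - ((\<eta> j \<bullet> z \<tau>) / (1 + \<eta> 1 \<bullet> z \<tau>)) *\<^sub>R (\<eta> 1 + z \<tau>))"

(* The rows are indexed by a type 'm of cardinality n - 1; idx i in {2..n} is the number j
   of the vector xi_j placed in row i. *)
definition Proj :: "('m::finite \<Rightarrow> nat) \<Rightarrow> (nat \<Rightarrow> 'n::finite) \<Rightarrow> (nat \<Rightarrow> real ^ 'n)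
    \<Rightarrow> (real \<Rightarrow> real ^ 'n) \<Rightarrow> real \<Rightarrow> real ^ 'n ^ 'm" where
  "Proj idx coord \<eta> z \<tau> = (\<chi> i. xi coord \<eta> z (idx i) \<tau>)"

end

theory Submission
  imports Defs
begin

text \<open>
  Write \<open>w(t) = x(t) - xstar(\<tau>(t))\<close>. Two facts carry the theorem.

  The first is algebraic: \<open>\<Pi>(s)\<^sup>T \<Pi>(s)\<close> fixes every vector orthogonal to \<open>z(s)\<close>
  (\<open>Proj_transpose_Proj\<close>). For \<open>n \<ge> 3\<close> the reason is that the formula for \<open>\<xi>\<^sub>j\<close> is the
  Householder reflection exchanging \<open>\<eta>\<^sub>1\<close> and \<open>- z\<close>, applied to \<open>\<eta>\<^sub>j\<close>; the reflection
  is an isometry, so it carries the orthonormal basis \<open>\<eta>\<close> to the orthonormal basis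
  \<open>- z, \<xi>\<^sub>2, \<dots>, \<xi>\<^sub>n\<close>, and the rows of \<open>\<Pi>\<close> are therefore an orthonormal basis of the complement
  of \<open>z\<close>. For \<open>n = 2\<close> the single row is \<open>z\<close> turned by a right angle. Since \<open>x(t)\<close> lies in the hyperplane \<open>S(\<tau>(t))\<close>, the vector \<open>w(t)\<close> is orthogonal to
  \<open>z(\<tau>(t))\<close>, and \<open>xperp\<close> determines \<open>w = \<Pi>\<^sup>T xperp\<close> and \<open>x = xstar(\<tau>) + \<Pi>\<^sup>T xperp\<close>.

  The second is that the merely continuous function \<open>\<tau>\<close> is differentiable. Freeze the time \<open>t\<close>
  and put \<open>g(s) = z(s) \<bullet> (x(t) - xstar(s))\<close>. Its derivative at \<open>\<tau>(t)\<close> is minus the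
  denominator in the equation for \<open>\<tau>\<close>, hence nonzero. The hyperplane condition at a nearby time \<open>r\<close>
  turns \<open>g(\<tau>(r))\<close> into \<open>- z(\<tau>(r)) \<bullet> (x(r) - x(t))\<close>, so \<open>g \<circ> \<tau>\<close> is differentiable at \<open>t\<close>
  with derivative \<open>- z(\<tau>(t)) \<bullet> f(x(t))\<close>. The chain rule can then be read backwards
  (\<open>has_real_derivative_cancel_compose\<close>): \<open>\<tau>\<close> is differentiable, with the quotient of the two
  derivatives as its derivative. This replaces the implicit function theorem.

  The equation for \<open>xperp\<close> is now the product rule applied to \<open>xperp = \<Pi>(\<tau>) w\<close>.
\<close>

section \<open>Differentiation\<close>

lemma bounded_bilinear_matrix_vector_mult:
  "bounded_bilinear (\<lambda>(A :: real ^ 'n ^ 'm) v. A *v v)"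
proof -
  have "bilinear (\<lambda>(A :: real ^ 'n ^ 'm) v. A *v v)"
    unfolding bilinear_def
    by (auto intro!: linearI simp: matrix_vector_mult_add_rdistrib scaleR_matrix_vector_assoc
        matrix_vector_right_distrib matrix_vector_mult_scaleR)
  then show ?thesis
    by (simp add: bilinear_conv_bounded_bilinear)
qed

lemma differentiable_vec_lambda:
  fixes F :: "'i::finite \<Rightarrow> 'a::euclidean_space \<Rightarrow> 'b::euclidean_space"
  assumes "\<And>i. F i differentiable (at a within S)"
  shows "(\<lambda>s. \<chi> i. F i s) differentiable (at a within S)"
proof -
  have "(\<lambda>s. (\<chi> i. F i s) \<bullet> axis k u) differentiable (at a within S)" if "u \<in> Basis" for k u
    using assms[of k] that unfolding inner_axis
    by (subst (asm) differentiable_componentwise_within) simp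
  then show ?thesis
    by (subst differentiable_componentwise_within) (auto simp: Basis_vec_def)
qed

lemma smooth_imp_differentiable:
  assumes "smooth f"
  shows "f differentiable (at x)"
  using assms Ck.simps(2)[of 0 f] unfolding smooth_def by blast

lemma has_vector_derivative_imp_quotient_tendsto:
  assumes "(x has_vector_derivative v) (at t)"
  shows "((\<lambda>r. (x r - x t) /\<^sub>R (r - t)) \<longlongrightarrow> v) (at t)"
proof -
  have "((\<lambda>r. norm (x r - x t - (r - t) *\<^sub>R v) / norm (r - t)) \<longlongrightarrow> 0) (at t)"
    using assms by (simp add: has_vector_derivative_def has_derivative_iff_norm)
  moreover have "\<forall>\<^sub>F r in at t. norm (x r - x t - (r - t) *\<^sub>R v) / norm (r - t)
      = norm ((x r - x t) /\<^sub>R (r - t) - v)"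
    unfolding eventually_at_topological
  proof (intro exI[of _ UNIV] conjI ballI impI)
    fix r assume "r \<noteq> t"
    then have "(x r - x t) /\<^sub>R (r - t) - v = (x r - x t - (r - t) *\<^sub>R v) /\<^sub>R (r - t)"
      by (simp add: scaleR_diff_right)
    then show "norm (x r - x t - (r - t) *\<^sub>R v) / norm (r - t)
        = norm ((x r - x t) /\<^sub>R (r - t) - v)"
      by (simp add: divide_inverse mult.commute)
  qed auto
  ultimately have "((\<lambda>r. norm ((x r - x t) /\<^sub>R (r - t) - v)) \<longlongrightarrow> 0) (at t)"
    by (rule Lim_transform_eventually)
  then show ?thesis
    using tendsto_norm_zero_iff LIM_zero_iff by blast
qed

text \<open>By Caratheodory, \<open>g(y) - g(\<tau>(t)) = q(y) (y - \<tau>(t))\<close> with \<open>q\<close> continuous and nonzero at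
  \<open>\<tau>(t)\<close>. Dividing by \<open>q(\<tau>(s))\<close> expresses the difference quotient of \<open>\<tau>\<close> through that of
  \<open>g \<circ> \<tau>\<close>; continuity of \<open>\<tau>\<close> suffices to pass to the limit.\<close>

lemma has_real_derivative_cancel_compose:
  fixes \<tau> g :: "real \<Rightarrow> real"
  assumes g: "(g has_real_derivative D) (at (\<tau> t))" and "D \<noteq> 0"
    and \<tau>: "isCont \<tau> t"
    and g\<tau>: "((\<lambda>s. g (\<tau> s)) has_real_derivative E) (at t)"
  shows "(\<tau> has_real_derivative E / D) (at t)"
proof -
  obtain q where q: "\<And>y. g y - g (\<tau> t) = q y * (y - \<tau> t)" "isCont q (\<tau> t)" "q (\<tau> t) = D"
    using g unfolding CARAT_DERIV by blast
  have "isCont (\<lambda>s. q (\<tau> s)) t"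
    by (rule isCont_o2[OF \<tau> q(2)])
  then have lim_q: "(\<lambda>s. q (\<tau> s)) \<midarrow>t\<rightarrow> D"
    using q(3) by (simp add: isCont_def)
  have "(\<lambda>s. (g (\<tau> s) - g (\<tau> t)) / (s - t) / q (\<tau> s)) \<midarrow>t\<rightarrow> E / D"
    by (rule tendsto_divide[OF g\<tau>[unfolded has_field_derivative_iff] lim_q \<open>D \<noteq> 0\<close>])
  moreover have "\<forall>\<^sub>F s in at t. (g (\<tau> s) - g (\<tau> t)) / (s - t) / q (\<tau> s) = (\<tau> s - \<tau> t) / (s - t)"
    using tendsto_imp_eventually_ne[OF lim_q \<open>D \<noteq> 0\<close>] by eventually_elim (simp add: q(1))
  ultimately show ?thesis
    unfolding has_field_derivative_iff by (blast intro: Lim_transform_eventually)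
qed

section \<open>The projection operator\<close>

text \<open>The reflection in the hyperplane orthogonal to \<open>a + z\<close>, for unit vectors \<open>a\<close> and \<open>z\<close>: the usual
  factor \<open>2 / norm (a + z)\<^sup>2\<close> equals \<open>1 / (1 + a \<bullet> z)\<close>.\<close>

definition householder :: "'a::real_inner \<Rightarrow> 'a \<Rightarrow> 'a \<Rightarrow> 'a" where
  "householder a z v = v - ((v \<bullet> (a + z)) / (1 + a \<bullet> z)) *\<^sub>R (a + z)"

lemma linear_householder: "linear (householder a z)"
  by (rule linearI) (simp_all add: householder_def inner_add_left add_divide_distrib algebra_simps)

lemma householder_symmetric: "householder a z u \<bullet> v = u \<bullet> householder a z v"
  by (simp add: householder_def inner_diff_left inner_diff_right inner_commute)

lemma householder_involution:
  assumes "norm a = 1" "norm z = 1" "1 + a \<bullet> z \<noteq> 0"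
  shows "householder a z (householder a z v) = v"
proof -
  have *: "(a + z) \<bullet> (a + z) = 2 * (1 + a \<bullet> z)"
    using assms(1,2) by (simp add: inner_add_left inner_add_right inner_commute norm_eq_1)
  have halve: "m - m / k * (2 * k) = - m" if "k \<noteq> 0" for m k :: real
    using that by simp
  have "householder a z v \<bullet> (a + z)
      = v \<bullet> (a + z) - (v \<bullet> (a + z)) / (1 + a \<bullet> z) * (2 * (1 + a \<bullet> z))"
    unfolding householder_def inner_diff_left inner_scaleR_left * ..
  also have "\<dots> = - (v \<bullet> (a + z))"
    using assms(3) halve by blast
  finally have "householder a z v \<bullet> (a + z) = - (v \<bullet> (a + z))" .
  then show ?thesis
    by (simp add: householder_def[of a z "householder a z v"]) (simp add: householder_def)
qed

lemma householder_swaps: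
  assumes "norm a = 1" "1 + a \<bullet> z \<noteq> 0"
  shows "householder a z a = - z"
  using assms by (simp add: householder_def inner_add_right norm_eq_1)

lemma orthonormal_basis_sum:
  fixes \<eta> :: "nat \<Rightarrow> real ^ 'n::finite"
  assumes "orthonormal_basis \<eta>"
  shows "(\<Sum>j\<in>{1..CARD('n)}. (v \<bullet> \<eta> j) *\<^sub>R \<eta> j) = v"
proof -
  let ?J = "{1..CARD('n)}"
  have ip: "\<And>i j. i \<in> ?J \<Longrightarrow> j \<in> ?J \<Longrightarrow> \<eta> i \<bullet> \<eta> j = (if i = j then 1 else 0)"
    and sp: "span (\<eta> ` ?J) = UNIV"
    using assms unfolding orthonormal_basis_def by auto
  have inj: "inj_on \<eta> ?J"
    by (rule inj_onI) (metis ip zero_neq_one)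
  have "(\<Sum>b\<in>\<eta> ` ?J. (v \<bullet> b) *\<^sub>R b) = v"
  proof (rule orthonormal_basis_expand)
    show "pairwise orthogonal (\<eta> ` ?J)"
      unfolding pairwise_image by (auto simp: pairwise_def orthogonal_def ip)
    show "\<And>b. b \<in> \<eta> ` ?J \<Longrightarrow> norm b = 1"
      using ip by (auto simp: norm_eq_1)
  qed (use sp in auto)
  then show ?thesis
    by (simp only: sum.reindex[OF inj] o_def)
qed

text \<open>Orthogonality of \<open>w\<close> to \<open>z\<close> says that its reflection is orthogonal to \<open>\<eta>\<^sub>1\<close>. Expand the
  reflection in \<open>\<eta>\<^sub>2, \<dots>, \<eta>\<^sub>n\<close> and reflect back.\<close>

lemma householder_basis_expand:
  fixes \<eta> :: "nat \<Rightarrow> real ^ 'n::finite"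
  assumes basis: "orthonormal_basis \<eta>"
    and z: "norm z = 1" "1 + \<eta> 1 \<bullet> z \<noteq> 0" and w: "z \<bullet> w = 0"
  shows "(\<Sum>j\<in>{2..CARD('n)}. (householder (\<eta> 1) z (\<eta> j) \<bullet> w) *\<^sub>R householder (\<eta> 1) z (\<eta> j)) = w"
proof -
  let ?H = "householder (\<eta> 1) z"
  have n: "1 \<le> CARD('n)"
    by (simp add: Suc_le_eq)
  then have "\<eta> 1 \<bullet> \<eta> 1 = 1"
    using basis unfolding orthonormal_basis_def by force
  then have \<eta>1: "norm (\<eta> 1) = 1"
    by (simp add: norm_eq_1)
  have "?H w \<bullet> \<eta> 1 = 0"
    using w unfolding householder_symmetric householder_swaps[OF \<eta>1 z(2)]
    by (simp add: inner_commute)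
  then have "(\<Sum>j\<in>{2..CARD('n)}. (?H w \<bullet> \<eta> j) *\<^sub>R \<eta> j) = ?H w"
    using orthonormal_basis_sum[OF basis, of "?H w"]
    by (simp only: sum.atLeast_Suc_atMost[OF n] Suc_1 scaleR_zero_left add_0_left)
  then have "?H (\<Sum>j\<in>{2..CARD('n)}. (?H w \<bullet> \<eta> j) *\<^sub>R \<eta> j) = w"
    by (simp only: householder_involution[OF \<eta>1 z])
  moreover have "?H w \<bullet> \<eta> j = ?H (\<eta> j) \<bullet> w" for j
    unfolding householder_symmetric[of _ _ w] by (rule inner_commute)
  ultimately show ?thesis
    by (simp only: linear_sum[OF linear_householder] linear_cmul[OF linear_householder] o_def)
qed

text \<open>Since \<open>\<eta>\<^sub>j\<close> is orthogonal to \<open>\<eta>\<^sub>1\<close> for \<open>j \<ge> 2\<close>, the reflection coefficient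
  \<open>\<eta>\<^sub>j \<bullet> (\<eta>\<^sub>1 + z)\<close> reduces to the \<open>\<eta>\<^sub>j \<bullet> z\<close> of the projection formula.\<close>

lemma xi_eq_householder:
  fixes \<eta> :: "nat \<Rightarrow> real ^ 'n::finite"
  assumes "CARD('n) \<ge> 3" "orthonormal_basis \<eta>" "j \<in> {2..CARD('n)}"
  shows "xi coord \<eta> z j s = householder (\<eta> 1) (z s) (\<eta> j)"
proof -
  have "\<eta> j \<bullet> \<eta> 1 = 0"
    using assms unfolding orthonormal_basis_def by auto
  then show ?thesis
    using assms(1) by (simp add: xi_def householder_def inner_add_right)
qed

text \<open>In the plane, \<open>\<xi>\<^sub>2\<close> is \<open>z\<close> turned by a right angle, so it spans the complement of \<open>z\<close>.\<close>

lemma xi_plane_expand: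
  fixes z :: "real \<Rightarrow> real ^ 'n::finite"
  assumes n: "CARD('n) = 2" and coord: "bij_betw coord {1..CARD('n)} UNIV"
    and z: "norm (z s) = 1" and w: "z s \<bullet> w = 0"
  shows "(xi coord \<eta> z j s \<bullet> w) *\<^sub>R xi coord \<eta> z j s = w"
proof -
  define a b where ab_def: "a = coord 1" "b = coord 2"
  have "{1..CARD('n)} = {1, 2}"
    using n by auto
  then have U: "UNIV = {a, b}" and ab: "a \<noteq> b"
    using coord by (auto simp: bij_betw_def inj_on_def ab_def)
  have inner: "u \<bullet> v = u $ a * v $ a + u $ b * v $ b" for u v :: "real ^ 'n"
    unfolding inner_vec_def U using ab by simp
  let ?p = "z s $ a" and ?q = "z s $ b" and ?u = "w $ a" and ?v = "w $ b"
  have z1: "?p * ?p + ?q * ?q = 1"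
    using z by (simp add: norm_eq_1 inner)
  have w0: "?p * ?u + ?q * ?v = 0"
    using w by (simp add: inner)
  have 1: "(- ?q * ?u + ?p * ?v) * (- ?q) = ?u" and 2: "(- ?q * ?u + ?p * ?v) * ?p = ?v"
    using z1 w0 by algebra+
  have xi: "xi coord \<eta> z j s = (\<chi> i. if i = a then - ?q else ?p)"
    unfolding xi_def ab_def n by (simp only: refl if_True)
  have "((xi coord \<eta> z j s \<bullet> w) *\<^sub>R xi coord \<eta> z j s) $ i = w $ i" for i
  proof -
    have "i = a \<or> i = b"
      using U by blast
    then show ?thesis
      using 1 2 ab by (auto simp: inner xi)
  qed
  then show ?thesis
    by (simp add: vec_eq_iff)
qed

lemma transpose_mult_eq_sum_rows:
  fixes A :: "real ^ 'n ^ 'm"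
  shows "transpose A *v (A *v w) = (\<Sum>i\<in>UNIV. (A $ i \<bullet> w) *\<^sub>R A $ i)"
  by (simp add: vec_eq_iff matrix_vector_mult_def transpose_def inner_vec_def mult.commute)

text \<open>The numbering \<open>idx\<close> turns the sum over rows into a sum over \<open>j = 2, \<dots>, n\<close>, which is the
  expansion of \<open>w\<close> in the reflected basis; in the plane this sum has the one term \<open>j = 2\<close>.\<close>

lemma Proj_transpose_Proj:
  fixes z :: "real \<Rightarrow> real ^ 'n::finite" and idx :: "'m::finite \<Rightarrow> nat"
  assumes n: "CARD('n) \<ge> 2"
    and coord: "bij_betw coord {1..CARD('n)} UNIV"
    and idx: "bij_betw idx UNIV {2..CARD('n)}"
    and basis: "CARD('n) \<ge> 3 \<Longrightarrow> orthonormal_basis \<eta>"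
    and z: "norm (z s) = 1" "CARD('n) \<ge> 3 \<Longrightarrow> 1 + \<eta> 1 \<bullet> z s \<noteq> 0"
    and w: "z s \<bullet> w = 0"
  shows "transpose (Proj idx coord \<eta> z s) *v (Proj idx coord \<eta> z s *v w) = w"
proof -
  let ?xi = "\<lambda>j. xi coord \<eta> z j s"
  have "transpose (Proj idx coord \<eta> z s) *v (Proj idx coord \<eta> z s *v w)
      = (\<Sum>i\<in>UNIV. (?xi (idx i) \<bullet> w) *\<^sub>R ?xi (idx i))"
    by (simp only: transpose_mult_eq_sum_rows Proj_def vec_lambda_beta)
  also have "\<dots> = (\<Sum>j\<in>{2..CARD('n)}. (?xi j \<bullet> w) *\<^sub>R ?xi j)"
    by (rule sum.reindex_bij_betw[OF idx])
  also have "\<dots> = w"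
  proof (cases "CARD('n) = 2")
    case True
    then show ?thesis
      using xi_plane_expand[where z = z and s = s, OF True coord z(1) w] by simp
  next
    case False
    with n have n3: "CARD('n) \<ge> 3"
      by simp
    have "(\<Sum>j\<in>{2..CARD('n)}. (?xi j \<bullet> w) *\<^sub>R ?xi j) =
        (\<Sum>j\<in>{2..CARD('n)}. (householder (\<eta> 1) (z s) (\<eta> j) \<bullet> w) *\<^sub>R householder (\<eta> 1) (z s) (\<eta> j))"
      by (intro sum.cong refl) (simp only: xi_eq_householder[OF n3 basis[OF n3]])
    also have "\<dots> = w"
      by (rule householder_basis_expand[OF basis[OF n3] z(1) z(2)[OF n3] w])
    finally show ?thesis .
  qed
  finally show ?thesis .
qed

lemma Proj_differentiable:
  fixes z :: "real \<Rightarrow> real ^ 'n::finite"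
  assumes z: "z differentiable (at s)"
    and ne: "CARD('n) \<noteq> 2 \<Longrightarrow> 1 + \<eta> 1 \<bullet> z s \<noteq> 0"
  shows "Proj idx coord \<eta> z differentiable (at s)"
proof -
  have "(\<lambda>s. xi coord \<eta> z j s) differentiable (at s)" for j
  proof (cases "CARD('n) = 2")
    case True
    have comp: "(\<lambda>s. z s $ k) differentiable (at s)" for k
      by (rule bounded_linear_imp_differentiable[OF bounded_linear_vec_nth,
            THEN differentiable_compose, OF z])
    have "(\<lambda>s. if i = coord 1 then - (z s $ coord 2) else z s $ coord 1) differentiable (at s)" for i
      by (cases "i = coord 1") (simp_all add: comp del: One_nat_def)
    then show ?thesis
      unfolding xi_def True by (simp only: refl if_True differentiable_vec_lambda)
  next
    case False
    then show ?thesis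
      unfolding xi_def using ne[OF False] z
      by (simp only: if_False)
        (intro differentiable_diff differentiable_const differentiable_scaleR differentiable_divide
          differentiable_inner differentiable_add)
  qed
  then show ?thesis
    unfolding Proj_def by (rule differentiable_vec_lambda)
qed

text \<open>Equality in the Cauchy--Schwarz inequality would force collinearity, so a field of unit vectors
  never collinear with \<open>\<eta>\<^sub>1\<close> makes the denominator in \<open>\<xi>\<^sub>j\<close> nonzero.\<close>

lemma inner_ne_minus_one:
  assumes "norm a = 1" "norm z = 1" "\<not> collinear {0, a, z}"
  shows "1 + a \<bullet> z \<noteq> 0"
  using assms norm_cauchy_schwarz_equal[of a z] by auto

section \<open>The transverse dynamics\<close>

theorem theorem1:
  fixes f :: "real ^ 'n \<Rightarrow> real ^ 'n"
    and xstar z x :: "real \<Rightarrow> real ^ 'n"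
    and T \<delta> :: real
    and \<eta> :: "nat \<Rightarrow> real ^ 'n"
    and coord :: "nat \<Rightarrow> 'n"
    and idx :: "'m::finite \<Rightarrow> nat"
    and I :: "real set"
    and \<tau> :: "real \<Rightarrow> real"
    and proj :: "real \<Rightarrow> real ^ 'n ^ 'm"
    and xperp :: "real \<Rightarrow> real ^ 'm"
  assumes "CARD('n) \<ge> 2"
    and "smooth f"
    and "T > 0"
    and "solution_on UNIV f xstar"
    and "\<And>t. xstar (t + T) = xstar t"
    and "\<not> xstar constant_on UNIV"
    and "\<And>t. f (xstar t) \<noteq> 0"
    and "smooth z"
    and "\<And>s. z (s + T) = z s"
    and "bounded (range (\<lambda>s. vector_derivative z (at s)))"
    and "\<And>s. norm (z s) = 1"
    and "\<delta> > 0"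
    and "\<And>s. z s \<bullet> f (xstar s) > \<delta>"
    and "bij_betw coord {1..CARD('n)} UNIV"
    and "bij_betw idx UNIV {2..CARD('n)}"
    and "CARD('n) \<ge> 3 \<Longrightarrow> orthonormal_basis \<eta>"
    and "\<And>s. CARD('n) \<ge> 3 \<Longrightarrow> \<not> collinear {0, \<eta> 1, z s}"
    and "open I" and "is_interval I"
    and "solution_on I f x"
    and "continuous_on I \<tau>"
    and "\<And>t. t \<in> I \<Longrightarrow> x t \<in> hyperplane z xstar (\<tau> t)"
    and proj_def: "proj = Proj idx coord \<eta> z"
    and xperp_def: "xperp = (\<lambda>t. proj (\<tau> t) *v (x t - xstar (\<tau> t)))"
    and "\<And>t. t \<in> I \<Longrightarrow>
           z (\<tau> t) \<bullet> f (xstar (\<tau> t))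
             - vector_derivative z (at (\<tau> t)) \<bullet> (transpose (proj (\<tau> t)) *v xperp t) \<noteq> 0"
  shows "\<forall>t\<in>I.
      \<tau> differentiable (at t) \<and> xperp differentiable (at t) \<and>
      vector_derivative xperp (at t) =
        deriv \<tau> t *\<^sub>R
          (vector_derivative proj (at (\<tau> t)) *v (transpose (proj (\<tau> t)) *v xperp t))
        + proj (\<tau> t) *v f (xstar (\<tau> t) + transpose (proj (\<tau> t)) *v xperp t)
        - deriv \<tau> t *\<^sub>R (proj (\<tau> t) *v f (xstar (\<tau> t))) \<and>
      deriv \<tau> t =
        (z (\<tau> t) \<bullet> f (xstar (\<tau> t) + transpose (proj (\<tau> t)) *v xperp t)) /
        (z (\<tau> t) \<bullet> f (xstar (\<tau> t))
           - vector_derivative z (at (\<tau> t)) \<bullet> (transpose (proj (\<tau> t)) *v xperp t))"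
proof -
  note n = assms(1) and z1 = assms(11) and basis = assms(16)
  have ne: "1 + \<eta> 1 \<bullet> z s \<noteq> 0" if "CARD('n) \<ge> 3" for s
  proof (rule inner_ne_minus_one)
    have "\<eta> 1 \<bullet> \<eta> 1 = 1"
      using basis[OF that] that unfolding orthonormal_basis_def by force
    then show "norm (\<eta> 1) = 1"
      by (simp add: norm_eq_1)
  qed (use z1 assms(17)[OF that] in auto)
  have z_der: "(z has_vector_derivative vector_derivative z (at s)) (at s)" for s
    using smooth_imp_differentiable[OF \<open>smooth z\<close>] vector_derivative_works by blast
  have proj_der: "(proj has_vector_derivative vector_derivative proj (at s)) (at s)" for s
  proof -
    have "Proj idx coord \<eta> z differentiable (at s)"
      by (rule Proj_differentiable[OF smooth_imp_differentiable[OF \<open>smooth z\<close>]]) (use ne n in auto)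
    then show ?thesis
      unfolding proj_def vector_derivative_works .
  qed
  have xstar_der: "(xstar has_vector_derivative f (xstar s)) (at s)" for s
    using \<open>solution_on UNIV f xstar\<close> by (simp add: solution_on_def)
  have x_der: "(x has_vector_derivative f (x t)) (at t)" if "t \<in> I" for t
    using \<open>solution_on I f x\<close> \<open>open I\<close> that by (metis solution_on_def at_within_open)
  have orth: "z (\<tau> t) \<bullet> (x t - xstar (\<tau> t)) = 0" if "t \<in> I" for t
    using assms(22)[OF that] by (simp add: hyperplane_def)
  have reconstruct: "transpose (proj (\<tau> t)) *v xperp t = x t - xstar (\<tau> t)" if "t \<in> I" for t
    unfolding proj_def xperp_def
    by (rule Proj_transpose_Proj[where z = z, OF n assms(14,15) basis z1 ne orth[OF that]])
  show ?thesis
  proof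
    fix t assume t: "t \<in> I"
    let ?s = "\<tau> t" and ?w = "x t - xstar (\<tau> t)"
    let ?D = "z ?s \<bullet> f (xstar ?s) - vector_derivative z (at ?s) \<bullet> ?w"
    let ?d = "z ?s \<bullet> f (x t) / ?D"
    have D: "?D \<noteq> 0"
      using assms(25)[OF t] unfolding reconstruct[OF t] .
    have \<tau>_cont: "isCont \<tau> t"
      using \<open>continuous_on I \<tau>\<close> \<open>open I\<close> t by (simp add: continuous_on_eq_continuous_at)

    \<comment> \<open>The time in \<open>x\<close> is frozen at \<open>t\<close>: only the argument of \<open>z\<close> and \<open>xstar\<close> varies.\<close>
    define g where "g s = z s \<bullet> (x t - xstar s)" for s
    have g_der: "(g has_real_derivative - ?D) (at ?s)"
    proof -
      have "((\<lambda>s. x t - xstar s) has_vector_derivative - f (xstar ?s)) (at ?s)"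
        using has_vector_derivative_diff[OF has_vector_derivative_const xstar_der] by simp
      from bounded_bilinear.has_vector_derivative[OF bounded_bilinear_inner z_der this]
      show ?thesis
        by (simp add: g_def[abs_def] has_real_derivative_iff_has_vector_derivative)
    qed
    have g\<tau>_der: "((\<lambda>r. g (\<tau> r)) has_real_derivative - (z ?s \<bullet> f (x t))) (at t)"
    proof -
      have "((\<lambda>r. (x r - x t) /\<^sub>R (r - t)) \<longlongrightarrow> f (x t)) (at t)"
        by (rule has_vector_derivative_imp_quotient_tendsto[OF x_der[OF t]])
      moreover have "((\<lambda>r. z (\<tau> r)) \<longlongrightarrow> z ?s) (at t)"
        using isCont_o2[OF \<tau>_cont has_vector_derivative_continuous[OF z_der]] by (simp add: isCont_def)
      ultimately have "((\<lambda>r. - (z (\<tau> r) \<bullet> ((x r - x t) /\<^sub>R (r - t)))) \<longlongrightarrow> - (z ?s \<bullet> f (x t))) (at t)"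
        by (intro tendsto_intros)
      moreover have "\<forall>\<^sub>F r in at t. - (z (\<tau> r) \<bullet> ((x r - x t) /\<^sub>R (r - t)))
          = (g (\<tau> r) - g (\<tau> t)) / (r - t)"
      proof -
        have "\<forall>\<^sub>F r in at t. r \<in> I"
          using \<open>open I\<close> t by (rule eventually_at_in_open')
        then show ?thesis
        proof eventually_elim
          case (elim r)
          \<comment> \<open>Since \<open>x r\<close> lies in its own hyperplane, \<open>xstar (\<tau> r)\<close> may be replaced by \<open>x r\<close>.\<close>
          have "g (\<tau> r) = - (z (\<tau> r) \<bullet> (x r - x t))"
            using orth[OF elim] by (simp add: g_def inner_diff_right)
          moreover have "g (\<tau> t) = 0"
            using orth[OF t] by (simp add: g_def)
          ultimately show ?case
            by (simp add: divide_inverse)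
        qed
      qed
      ultimately show ?thesis
        unfolding has_field_derivative_iff by (blast intro: Lim_transform_eventually)
    qed
    have \<tau>_der: "(\<tau> has_real_derivative ?d) (at t)"
      using has_real_derivative_cancel_compose[OF g_der _ \<tau>_cont g\<tau>_der] D
      by (simp add: minus_divide_divide del: minus_diff_eq)
    then have \<tau>_vder: "(\<tau> has_vector_derivative ?d) (at t)"
      by (simp add: has_real_derivative_iff_has_vector_derivative)

    have "((\<lambda>r. xstar (\<tau> r)) has_vector_derivative ?d *\<^sub>R f (xstar ?s)) (at t)"
      and proj_\<tau>: "((\<lambda>r. proj (\<tau> r)) has_vector_derivative ?d *\<^sub>R vector_derivative proj (at ?s)) (at t)"
      using vector_diff_chain_at[OF \<tau>_vder xstar_der] vector_diff_chain_at[OF \<tau>_vder proj_der]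
      by (simp_all add: o_def)
    then have w_der: "((\<lambda>r. x r - xstar (\<tau> r)) has_vector_derivative f (x t) - ?d *\<^sub>R f (xstar ?s)) (at t)"
      by (intro has_vector_derivative_diff x_der[OF t])
    have xperp_der: "(xperp has_vector_derivative
        proj ?s *v (f (x t) - ?d *\<^sub>R f (xstar ?s))
        + (?d *\<^sub>R vector_derivative proj (at ?s)) *v ?w) (at t)"
      unfolding xperp_def
      by (rule bounded_bilinear.has_vector_derivative[OF bounded_bilinear_matrix_vector_mult proj_\<tau> w_der])

    have "\<tau> differentiable (at t)" "xperp differentiable (at t)"
      using \<tau>_vder xperp_der by (auto intro: differentiableI_vector)
    moreover have "deriv \<tau> t = ?d"
      by (rule DERIV_imp_deriv[OF \<tau>_der])
    moreover have "vector_derivative xperp (at t) =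
        ?d *\<^sub>R (vector_derivative proj (at ?s) *v ?w) + proj ?s *v f (x t)
          - ?d *\<^sub>R (proj ?s *v f (xstar ?s))"
      unfolding vector_derivative_at[OF xperp_der]
      by (simp add: matrix_vector_mult_diff_distrib matrix_vector_mult_scaleR
          scaleR_matrix_vector_assoc[symmetric] scaleR_diff_right)
    ultimately show "\<tau> differentiable (at t) \<and> xperp differentiable (at t) \<and>
      vector_derivative xperp (at t) =
        deriv \<tau> t *\<^sub>R
          (vector_derivative proj (at (\<tau> t)) *v (transpose (proj (\<tau> t)) *v xperp t))
        + proj (\<tau> t) *v f (xstar (\<tau> t) + transpose (proj (\<tau> t)) *v xperp t)
        - deriv \<tau> t *\<^sub>R (proj (\<tau> t) *v f (xstar (\<tau> t))) \<and>
      deriv \<tau> t =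
        (z (\<tau> t) \<bullet> f (xstar (\<tau> t) + transpose (proj (\<tau> t)) *v xperp t)) /
        (z (\<tau> t) \<bullet> f (xstar (\<tau> t))
           - vector_derivative z (at (\<tau> t)) \<bullet> (transpose (proj (\<tau> t)) *v xperp t))"
      unfolding reconstruct[OF t] by simp
  qed
qed

end
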